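(* Let $M^{2n+1}(f,Q,\xi,\eta,g)$ be a weak quasi-contact metric manifold satisfying $$R_{X,\xi}\,\xi=X-\eta(X)\,\xi\qquad (X\in\mathfrak{X}_M).$$ If $\xi$ is a Killing vector field, then $Q={\rm id}$ and $M(f,\xi,\eta,g)$ is a K-contact manifold.
   Context: $\mathfrak{X}_M$ denotes the Lie algebra of smooth vector fields on a smooth manifold $M$ of dimension $2n+1$, and $\nabla$ is the Levi-Civita connection of $g$. The curvature tensor is $R_{X,Y}Z=\nabla_X\nabla_YZ-\nabla_Y\nabla_XZ-\nabla_{[X,Y]}Z$. A weak almost-contact metric structure $(f,Q,\xi,\eta,g)$ on $M^{2n+1}$ consists of a $(1,1)$-tensor $f$, a nonsingular $(1,1)$-tensor $Q$, a vector field $\xi$, a 1-form $\eta$ and a Riemannian metric $g$ such that $f^2=-Q+\eta\otimes\xi$, $\eta(\xi)=1$, $g(fX,fY)=g(X,QY)-\eta(X)\eta(Y)$, $\eta(X)=g(\xi,X)$ for all $X,Y\in\mathfrak{X}_M$. (Then $f\xi=0$, $\eta\circ f=0$, $\eta\circ Q=\eta$, $Q\xi=\xi$, $Qf=fQ$, $f$ is skew-symmetric, $Q$ is self-adjoint and positive definite, and ${\rm rank}\,f=2n$.) When $Q={\rm id}$, the structure $(f,\xi,\eta,g)$ is called an almost-contact metric structure. The $(1,1)$-tensor $h$ is $h=\frac12\,\mathcal{L}_\xi f$, where $(\mathcal{L}_Z f)X=[Z,fX]-f[Z,X]$. A weak quasi-contact metric manifold is one with a weak almost-contact metric structure satisfying,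 for all $X,Y\in\mathfrak{X}_M$, $$(\nabla_X f)Y+(\nabla_{fX}f)fY=2\,g(X,Y)\,\xi-\eta(Y)\big(X+hX+\eta(X)\,\xi\big).$$ A contact metric manifold is an almost-contact metric manifold with $d\eta=\Phi$, where $\Phi(X,Y)=g(X,fY)$ and $2\,d\eta(X,Y)=X(\eta(Y))-Y(\eta(X))-\eta([X,Y])$. A K-contact manifold is a contact metric manifold for which $\xi$ is a Killing vector field. *)

theory Defs
  imports "HOL-Analysis.Analysis" "HOL-Library.Function_Algebras"
begin

text \<open>
  Sums, differences and products of real functions and of vector fields are the pointwise ones
  of \<^theory>\<open>HOL-Library.Function_Algebras\<close>.
\<close>

section \<open>Smooth manifolds\<close>

text \<open>For open \<open>S\<close> in a Euclidean space this is the class \<open>C\<^sup>k(S)\<close>.\<close>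

primrec Ck_on :: "nat \<Rightarrow> ('e::euclidean_space \<Rightarrow> 'f::real_normed_vector) \<Rightarrow> 'e set \<Rightarrow> bool" where
  "Ck_on 0 F S \<longleftrightarrow> continuous_on S F"
| "Ck_on (Suc k) F S \<longleftrightarrow>
     (\<forall>x\<in>S. F differentiable (at x)) \<and> (\<forall>v. Ck_on k (\<lambda>x. frechet_derivative F (at x) v) S)"

definition smooth_on :: "('e::euclidean_space \<Rightarrow> 'f::real_normed_vector) \<Rightarrow> 'e set \<Rightarrow> bool" where
  "smooth_on F S \<longleftrightarrow> (\<forall>k. Ck_on k F S)"

text \<open>
  The manifold is the whole (Hausdorff, second countable) type \<open>'m\<close>; its smooth structure is given
  by an atlas, which need not be maximal, and its dimension is \<open>DIM('e)\<close>. A chart is a pair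
  \<open>(U, \<phi>)\<close>; the values of \<open>\<phi>\<close> off \<open>U\<close> are irrelevant.
\<close>

type_synonym ('m, 'e) chart = "'m set \<times> ('m \<Rightarrow> 'e)"

definition smooth_atlas ::
  "('m::{t2_space, second_countable_topology}, 'e::euclidean_space) chart set \<Rightarrow> bool" where
  "smooth_atlas A \<longleftrightarrow>
     (\<Union>(U, \<phi>)\<in>A. U) = UNIV \<and>
     (\<forall>(U, \<phi>)\<in>A. open U \<and> open (\<phi> ` U) \<and> homeomorphism U (\<phi> ` U) \<phi> (inv_into U \<phi>)) \<and>
     (\<forall>(U, \<phi>)\<in>A. \<forall>(V, \<psi>)\<in>A. smooth_on (\<psi> \<circ> inv_into U \<phi>) (\<phi> ` (U \<inter> V)))"

definition smooth_fun ::
  "('m::{t2_space, second_countable_topology}, 'e::euclidean_space) chart set \<Rightarrow> ('m \<Rightarrow> real) \<Rightarrow> bool" where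
  "smooth_fun A a \<longleftrightarrow> (\<forall>(U, \<phi>)\<in>A. smooth_on (a \<circ> inv_into U \<phi>) (\<phi> ` U))"


section \<open>Vector fields\<close>

text \<open>
  A tangent vector at \<open>p\<close> is a derivation at \<open>p\<close> of the algebra of smooth functions. It is made
  \<open>0\<close> on functions that are not smooth, so that equality in HOL is equality of derivations.
\<close>

type_synonym 'm tangent = "('m \<Rightarrow> real) \<Rightarrow> real"

definition tangent_space ::
  "('m::{t2_space, second_countable_topology}, 'e::euclidean_space) chart set \<Rightarrow> 'm \<Rightarrow> 'm tangent set" where
  "tangent_space A p = {v.
     (\<forall>a b. smooth_fun A a \<longrightarrow> smooth_fun A b \<longrightarrow> v (a + b) = v a + v b) \<and>
     (\<forall>c a. smooth_fun A a \<longrightarrow> v (\<lambda>q. c * a q) = c * v a) \<and>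
     (\<forall>a b. smooth_fun A a \<longrightarrow> smooth_fun A b \<longrightarrow> v (a * b) = v a * b p + a p * v b) \<and>
     (\<forall>a. \<not> smooth_fun A a \<longrightarrow> v a = 0)}"

type_synonym 'm vfield = "'m \<Rightarrow> 'm tangent"

definition act :: "'m vfield \<Rightarrow> ('m \<Rightarrow> real) \<Rightarrow> ('m \<Rightarrow> real)" where
  "act X a = (\<lambda>p. X p a)"

definition vector_fields ::
  "('m::{t2_space, second_countable_topology}, 'e::euclidean_space) chart set \<Rightarrow> 'm vfield set" where
  "vector_fields A =
     {X. (\<forall>p. X p \<in> tangent_space A p) \<and> (\<forall>a. smooth_fun A a \<longrightarrow> smooth_fun A (act X a))}"

definition scale :: "('m \<Rightarrow> real) \<Rightarrow> 'm vfield \<Rightarrow> 'm vfield"  (infixr \<open>\<odot>\<close> 75) where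
  "a \<odot> X = (\<lambda>p u. a p * X p u)"

definition lie_bracket ::
  "('m::{t2_space, second_countable_topology}, 'e::euclidean_space) chart set
    \<Rightarrow> 'm vfield \<Rightarrow> 'm vfield \<Rightarrow> 'm vfield" where
  "lie_bracket A X Y =
     (\<lambda>p a. if smooth_fun A a then X p (act Y a) - Y p (act X a) else 0)"


section \<open>Tensor fields and Riemannian metrics\<close>

text \<open>
  Tensor fields are maps on vector fields that are multilinear over the ring of smooth functions.
  Their values on arguments outside \<^term>\<open>vector_fields A\<close> are irrelevant.
\<close>

definition tensor_1_1 ::
  "('m::{t2_space, second_countable_topology}, 'e::euclidean_space) chart set
    \<Rightarrow> ('m vfield \<Rightarrow> 'm vfield) \<Rightarrow> bool" where
  "tensor_1_1 A T \<longleftrightarrow>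
     (\<forall>X\<in>vector_fields A. T X \<in> vector_fields A) \<and>
     (\<forall>X\<in>vector_fields A. \<forall>Y\<in>vector_fields A. T (X + Y) = T X + T Y) \<and>
     (\<forall>X\<in>vector_fields A. \<forall>a. smooth_fun A a \<longrightarrow> T (a \<odot> X) = a \<odot> T X)"

text \<open>
  An endomorphism of the tangent bundle is invertible at every point iff it is bijective on
  vector fields.
\<close>

definition nonsingular ::
  "('m::{t2_space, second_countable_topology}, 'e::euclidean_space) chart set
    \<Rightarrow> ('m vfield \<Rightarrow> 'm vfield) \<Rightarrow> bool" where
  "nonsingular A T \<longleftrightarrow> bij_betw T (vector_fields A) (vector_fields A)"

definition one_form ::
  "('m::{t2_space, second_countable_topology}, 'e::euclidean_space) chart set
    \<Rightarrow> ('m vfield \<Rightarrow> 'm \<Rightarrow> real) \<Rightarrow> bool" where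
  "one_form A \<omega> \<longleftrightarrow>
     (\<forall>X\<in>vector_fields A. smooth_fun A (\<omega> X)) \<and>
     (\<forall>X\<in>vector_fields A. \<forall>Y\<in>vector_fields A. \<omega> (X + Y) = \<omega> X + \<omega> Y) \<and>
     (\<forall>X\<in>vector_fields A. \<forall>a. smooth_fun A a \<longrightarrow> \<omega> (a \<odot> X) = a * \<omega> X)"

definition riemannian_metric ::
  "('m::{t2_space, second_countable_topology}, 'e::euclidean_space) chart set
    \<Rightarrow> ('m vfield \<Rightarrow> 'm vfield \<Rightarrow> 'm \<Rightarrow> real) \<Rightarrow> bool" where
  "riemannian_metric A g \<longleftrightarrow>
     (\<forall>X\<in>vector_fields A. one_form A (g X)) \<and>
     (\<forall>X\<in>vector_fields A. \<forall>Y\<in>vector_fields A. g X Y = g Y X) \<and>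
     (\<forall>X\<in>vector_fields A. \<forall>p. X p \<noteq> 0 \<longrightarrow> g X X p > 0)"

definition levi_civita ::
  "('m::{t2_space, second_countable_topology}, 'e::euclidean_space) chart set
    \<Rightarrow> ('m vfield \<Rightarrow> 'm vfield \<Rightarrow> 'm \<Rightarrow> real) \<Rightarrow> ('m vfield \<Rightarrow> 'm vfield \<Rightarrow> 'm vfield) \<Rightarrow> bool" where
  "levi_civita A g nabla \<longleftrightarrow>
     (\<forall>Y\<in>vector_fields A. tensor_1_1 A (\<lambda>X. nabla X Y)) \<and>
     (\<forall>X\<in>vector_fields A. \<forall>Y\<in>vector_fields A. \<forall>Z\<in>vector_fields A.
        nabla X (Y + Z) = nabla X Y + nabla X Z) \<and>
     (\<forall>X\<in>vector_fields A. \<forall>Y\<in>vector_fields A. \<forall>a. smooth_fun A a \<longrightarrow>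
        nabla X (a \<odot> Y) = act X a \<odot> Y + a \<odot> nabla X Y) \<and>
     (\<forall>X\<in>vector_fields A. \<forall>Y\<in>vector_fields A.
        nabla X Y - nabla Y X = lie_bracket A X Y) \<and>
     (\<forall>X\<in>vector_fields A. \<forall>Y\<in>vector_fields A. \<forall>Z\<in>vector_fields A.
        act X (g Y Z) = g (nabla X Y) Z + g Y (nabla X Z))"

definition curvature ::
  "('m::{t2_space, second_countable_topology}, 'e::euclidean_space) chart set
    \<Rightarrow> ('m vfield \<Rightarrow> 'm vfield \<Rightarrow> 'm vfield) \<Rightarrow> 'm vfield \<Rightarrow> 'm vfield \<Rightarrow> 'm vfield \<Rightarrow> 'm vfield" where
  "curvature A nabla X Y Z =
     nabla X (nabla Y Z) - nabla Y (nabla X Z) - nabla (lie_bracket A X Y) Z"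

text \<open>\<^term>\<open>cov_deriv nabla X T Y\<close> is \<open>(\<nabla>\<^sub>X T)Y\<close>.\<close>

definition cov_deriv ::
  "('m vfield \<Rightarrow> 'm vfield \<Rightarrow> 'm vfield) \<Rightarrow> 'm vfield \<Rightarrow> ('m vfield \<Rightarrow> 'm vfield) \<Rightarrow> 'm vfield \<Rightarrow> 'm vfield" where
  "cov_deriv nabla X T Y = nabla X (T Y) - T (nabla X Y)"

definition lie_deriv ::
  "('m::{t2_space, second_countable_topology}, 'e::euclidean_space) chart set
    \<Rightarrow> 'm vfield \<Rightarrow> ('m vfield \<Rightarrow> 'm vfield) \<Rightarrow> 'm vfield \<Rightarrow> 'm vfield" where
  "lie_deriv A Z T X = lie_bracket A Z (T X) - T (lie_bracket A Z X)"

definition killing ::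
  "('m::{t2_space, second_countable_topology}, 'e::euclidean_space) chart set
    \<Rightarrow> ('m vfield \<Rightarrow> 'm vfield \<Rightarrow> 'm \<Rightarrow> real) \<Rightarrow> 'm vfield \<Rightarrow> bool" where
  "killing A g Z \<longleftrightarrow> Z \<in> vector_fields A \<and>
     (\<forall>X\<in>vector_fields A. \<forall>Y\<in>vector_fields A.
        act Z (g X Y) - g (lie_bracket A Z X) Y - g X (lie_bracket A Z Y) = 0)"

text \<open>The normalisation with the factor \<open>1/2\<close> is part of the convention.\<close>

definition ext_deriv ::
  "('m::{t2_space, second_countable_topology}, 'e::euclidean_space) chart set
    \<Rightarrow> ('m vfield \<Rightarrow> 'm \<Rightarrow> real) \<Rightarrow> 'm vfield \<Rightarrow> 'm vfield \<Rightarrow> 'm \<Rightarrow> real" where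
  "ext_deriv A \<omega> X Y =
     (\<lambda>p. 1 / 2 * (act X (\<omega> Y) p - act Y (\<omega> X) p - \<omega> (lie_bracket A X Y) p))"


section \<open>Weak almost-contact metric structures\<close>

definition weak_almost_contact_metric ::
  "('m::{t2_space, second_countable_topology}, 'e::euclidean_space) chart set
    \<Rightarrow> ('m vfield \<Rightarrow> 'm vfield) \<Rightarrow> ('m vfield \<Rightarrow> 'm vfield) \<Rightarrow> 'm vfield
    \<Rightarrow> ('m vfield \<Rightarrow> 'm \<Rightarrow> real) \<Rightarrow> ('m vfield \<Rightarrow> 'm vfield \<Rightarrow> 'm \<Rightarrow> real) \<Rightarrow> bool" where
  "weak_almost_contact_metric A f Q \<xi> \<eta> g \<longleftrightarrow>
     tensor_1_1 A f \<and> tensor_1_1 A Q \<and> nonsingular A Q \<and>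
     \<xi> \<in> vector_fields A \<and> one_form A \<eta> \<and> riemannian_metric A g \<and>
     (\<forall>X\<in>vector_fields A. f (f X) = - Q X + \<eta> X \<odot> \<xi>) \<and>
     \<eta> \<xi> = 1 \<and>
     (\<forall>X\<in>vector_fields A. \<forall>Y\<in>vector_fields A. g (f X) (f Y) = g X (Q Y) - \<eta> X * \<eta> Y) \<and>
     (\<forall>X\<in>vector_fields A. \<eta> X = g \<xi> X)"

definition h_tensor ::
  "('m::{t2_space, second_countable_topology}, 'e::euclidean_space) chart set
    \<Rightarrow> ('m vfield \<Rightarrow> 'm vfield) \<Rightarrow> 'm vfield \<Rightarrow> 'm vfield \<Rightarrow> 'm vfield" where
  "h_tensor A f \<xi> X = (\<lambda>_. 1 / 2) \<odot> lie_deriv A \<xi> f X"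

definition weak_quasi_contact_metric ::
  "('m::{t2_space, second_countable_topology}, 'e::euclidean_space) chart set
    \<Rightarrow> ('m vfield \<Rightarrow> 'm vfield) \<Rightarrow> ('m vfield \<Rightarrow> 'm vfield) \<Rightarrow> 'm vfield
    \<Rightarrow> ('m vfield \<Rightarrow> 'm \<Rightarrow> real) \<Rightarrow> ('m vfield \<Rightarrow> 'm vfield \<Rightarrow> 'm \<Rightarrow> real)
    \<Rightarrow> ('m vfield \<Rightarrow> 'm vfield \<Rightarrow> 'm vfield) \<Rightarrow> bool" where
  "weak_quasi_contact_metric A f Q \<xi> \<eta> g nabla \<longleftrightarrow>
     weak_almost_contact_metric A f Q \<xi> \<eta> g \<and> levi_civita A g nabla \<and>
     (\<forall>X\<in>vector_fields A. \<forall>Y\<in>vector_fields A.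
        cov_deriv nabla X f Y + cov_deriv nabla (f X) f (f Y) =
        (\<lambda>p. 2 * g X Y p) \<odot> \<xi> - \<eta> Y \<odot> (X + h_tensor A f \<xi> X + \<eta> X \<odot> \<xi>))"

definition almost_contact_metric ::
  "('m::{t2_space, second_countable_topology}, 'e::euclidean_space) chart set
    \<Rightarrow> ('m vfield \<Rightarrow> 'm vfield) \<Rightarrow> 'm vfield
    \<Rightarrow> ('m vfield \<Rightarrow> 'm \<Rightarrow> real) \<Rightarrow> ('m vfield \<Rightarrow> 'm vfield \<Rightarrow> 'm \<Rightarrow> real) \<Rightarrow> bool" where
  "almost_contact_metric A f \<xi> \<eta> g \<longleftrightarrow> weak_almost_contact_metric A f id \<xi> \<eta> g"

definition contact_metric ::
  "('m::{t2_space, second_countable_topology}, 'e::euclidean_space) chart set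
    \<Rightarrow> ('m vfield \<Rightarrow> 'm vfield) \<Rightarrow> 'm vfield
    \<Rightarrow> ('m vfield \<Rightarrow> 'm \<Rightarrow> real) \<Rightarrow> ('m vfield \<Rightarrow> 'm vfield \<Rightarrow> 'm \<Rightarrow> real) \<Rightarrow> bool" where
  "contact_metric A f \<xi> \<eta> g \<longleftrightarrow> almost_contact_metric A f \<xi> \<eta> g \<and>
     (\<forall>X\<in>vector_fields A. \<forall>Y\<in>vector_fields A. ext_deriv A \<eta> X Y = g X (f Y))"

definition K_contact ::
  "('m::{t2_space, second_countable_topology}, 'e::euclidean_space) chart set
    \<Rightarrow> ('m vfield \<Rightarrow> 'm vfield) \<Rightarrow> 'm vfield
    \<Rightarrow> ('m vfield \<Rightarrow> 'm \<Rightarrow> real) \<Rightarrow> ('m vfield \<Rightarrow> 'm vfield \<Rightarrow> 'm \<Rightarrow> real) \<Rightarrow> bool" where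
  "K_contact A f \<xi> \<eta> g \<longleftrightarrow> contact_metric A f \<xi> \<eta> g \<and> killing A g \<xi>"

end

theory Submission
  imports Defs
begin

text \<open>
  All steps are identities between smooth functions and vector fields, where an equation \<open>X = 0\<close> is
  obtained from \<open>g(X, X) = 0\<close>. Write \<open>\<phi>X = \<nabla>\<^sub>X\<xi>\<close> and \<open>D\<^sub>X = \<nabla>\<^sub>Xf\<close>, and let \<open>(E)\<close> be the quasi-contact
  equation \<open>D\<^sub>XY + D\<^bsub>fX\<^esub>fY = 2g(X,Y)\<xi> - \<eta>(Y)(X + hX + \<eta>(X)\<xi>)\<close>.

  The operator \<open>f\<close> is skew: \<open>f\<^sup>*f = -f\<^sup>2\<close> makes the symmetric form \<open>g(fX,Y) + g(X,fY)\<close> vanish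
  on the image of \<open>f\<close>, and since \<open>Q = \<eta> \<otimes> \<xi> - f\<^sup>2\<close> is onto, only its value on \<open>(\<xi>, \<xi>)\<close> remains
  to be killed (\<open>f_skew_adjoint\<close>). Hence every \<open>D\<^sub>X\<close> is skew too. The identity \<open>f\<xi> = 0\<close> does not follow from the
  algebra of \<open>f\<close>, \<open>Q\<close>, \<open>\<xi>\<close> at a point: if, in three-space, \<open>f\<close> annihilates an axis and turns the
  orthogonal plane by a right angle, and \<open>\<xi>\<close> is any unit vector not orthogonal to that axis, then \<open>Q = \<eta> \<otimes> \<xi> - f\<^sup>2\<close> completes a weak almost-contact
  metric structure. It is forced by two instances of \<open>(E)\<close> paired with suitable vectors (\<open>f_xi\<close>).

  For a unit Killing field \<open>\<phi>\<close> is skew and \<open>\<phi>\<xi> = 0\<close>, so the hypothesis on \<open>R\<^bsub>X,\<xi>\<^esub>\<xi>\<close> says that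
  \<open>-\<nabla>\<^sub>\<xi>\<phi> - \<phi>\<^sup>2 = id - \<eta> \<otimes> \<xi>\<close>. The first term is skew and the others are self-adjoint, so
  \<open>\<phi>\<^sup>2 = \<eta> \<otimes> \<xi> - id\<close> (\<open>killing_curvature_imp_square\<close>).

  Now \<open>(E)\<close> becomes algebra in \<open>f\<close> and \<open>\<phi>\<close>. With \<open>X = \<xi>\<close> it gives \<open>D\<^sub>\<xi> = 0\<close>, so \<open>2h = f\<phi> - \<phi>f\<close>;
  with \<open>Y = \<xi>\<close> it gives \<open>h = f\<phi> + \<phi>\<^sup>2\<close>. Together, \<open>f\<phi> + \<phi>f = -2\<phi>\<^sup>2\<close>. The \<open>\<xi>\<close>-component of \<open>(E)\<close> is
  \<open>f\<phi> + Q\<phi>f = -2\<phi>\<^sup>2\<close>, so \<open>Q\<phi>f = \<phi>f\<close>. On the orthogonal complement of \<open>\<xi>\<close> both \<open>\<phi>\<close> and \<open>f\<close> are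
  invertible, hence \<open>Q = id\<close> (\<open>Q_eq_id\<close>). Then \<open>f\<^sup>2 = \<phi>\<^sup>2\<close>, so \<open>(f + \<phi>)\<^sup>2 = 2\<phi>\<^sup>2 - 2\<phi>\<^sup>2 = 0\<close>, and a
  skew operator with square zero vanishes: \<open>f = -\<phi>\<close> (\<open>f_eq_uminus_phi\<close>). Since
  \<open>d\<eta>(X,Y) = g(\<phi>X,Y)\<close> for a Killing field, this is the contact condition.
\<close>

section \<open>Smooth functions and vector fields\<close>

text \<open>
  Openness is essential: the derivatives in the definition of \<^const>\<open>Ck_on\<close> are not taken within
  the set, so they depend on the function near each point.
\<close>

lemma Ck_on_cong:
  assumes "open S" "\<And>x. x \<in> S \<Longrightarrow> F x = G x" "Ck_on k F S"
  shows "Ck_on k G S"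
  using assms(2,3)
proof (induction k arbitrary: F G)
  case 0
  then show ?case by (metis Ck_on.simps(1) continuous_on_cong)
next
  case (Suc k)
  have G: "(G has_derivative frechet_derivative F (at x)) (at x)" if "x \<in> S" for x
    using Suc.prems that assms(1)
    by (intro has_derivative_transform_within_open[of F _ x UNIV S G])
       (auto simp: frechet_derivative_works)
  have "frechet_derivative F (at x) = frechet_derivative G (at x)" if "x \<in> S" for x
    using G[OF that] by (rule frechet_derivative_at)
  then show ?case
    using Suc.prems(2) G Suc.IH[of "\<lambda>x. frechet_derivative F (at x) v"
        "\<lambda>x. frechet_derivative G (at x) v" for v]
    by (auto simp: differentiable_def)
qed

lemma Ck_on_Suc_imp: "Ck_on (Suc k) F S \<Longrightarrow> Ck_on k F S"
proof (induction k arbitrary: F)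
  case 0
  then show ?case
    by (auto intro!: continuous_at_imp_continuous_on differentiable_imp_continuous_within)
next
  case (Suc k)
  then show ?case by (metis Ck_on.simps(2))
qed

lemma Ck_on_const: "Ck_on k (\<lambda>x. c) S"
  by (induction k arbitrary: c) (auto simp: frechet_derivative_const)

lemma Ck_on_add:
  fixes F G :: "'e::euclidean_space \<Rightarrow> real"
  assumes "open S" "Ck_on k F S" "Ck_on k G S"
  shows "Ck_on k (\<lambda>x. F x + G x) S"
  using assms(2,3)
proof (induction k arbitrary: F G)
  case 0
  then show ?case by (auto intro: continuous_on_add)
next
  case (Suc k)
  have d: "((\<lambda>x. F x + G x) has_derivative
      (\<lambda>v. frechet_derivative F (at x) v + frechet_derivative G (at x) v)) (at x)"
    if "x \<in> S" for x
    using Suc.prems that by (auto intro!: has_derivative_add simp: frechet_derivative_works)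
  have "Ck_on k (\<lambda>x. frechet_derivative (\<lambda>x. F x + G x) (at x) v) S" for v
    using Suc.prems by (rule_tac Ck_on_cong[OF assms(1) _ Suc.IH])
      (auto simp: frechet_derivative_at[OF d, symmetric])
  then show ?case using d by (auto simp: differentiable_def)
qed

lemma Ck_on_mult:
  fixes F G :: "'e::euclidean_space \<Rightarrow> real"
  assumes "open S" "Ck_on k F S" "Ck_on k G S"
  shows "Ck_on k (\<lambda>x. F x * G x) S"
  using assms(2,3)
proof (induction k arbitrary: F G)
  case 0
  then show ?case by (auto intro: continuous_on_mult)
next
  case (Suc k)
  have d: "((\<lambda>x. F x * G x) has_derivative
      (\<lambda>v. F x * frechet_derivative G (at x) v + frechet_derivative F (at x) v * G x)) (at x)"
    if "x \<in> S" for x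
    using Suc.prems that by (auto intro!: has_derivative_mult simp: frechet_derivative_works)
  have "Ck_on k (\<lambda>x. F x * frechet_derivative G (at x) v + frechet_derivative F (at x) v * G x) S"
    for v
    using Suc.prems Ck_on_Suc_imp[OF Suc.prems(1)] Ck_on_Suc_imp[OF Suc.prems(2)]
    by (auto intro!: Ck_on_add[OF assms(1)] Suc.IH)
  then have "Ck_on k (\<lambda>x. frechet_derivative (\<lambda>x. F x * G x) (at x) v) S" for v
    by (rule Ck_on_cong[OF assms(1), rotated]) (auto simp: frechet_derivative_at[OF d, symmetric])
  then show ?case using d by (auto simp: differentiable_def)
qed

locale smooth_manifold =
  fixes A :: "('m::{t2_space, second_countable_topology}, 'e::euclidean_space) chart set"
  assumes atlas: "smooth_atlas A"
begin

abbreviation V :: "'m vfield set" where "V \<equiv> vector_fields A"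

lemma open_chart_image: "(U, \<phi>) \<in> A \<Longrightarrow> open (\<phi> ` U)"
  using atlas by (auto simp: smooth_atlas_def)

lemma smooth_fun_const [simp]: "smooth_fun A (\<lambda>_. c)"
  by (auto simp: smooth_fun_def smooth_on_def comp_def Ck_on_const)

lemma smooth_fun_add: "smooth_fun A a \<Longrightarrow> smooth_fun A b \<Longrightarrow> smooth_fun A (a + b)"
  by (fastforce simp: smooth_fun_def smooth_on_def comp_def
      intro: Ck_on_add open_chart_image)

lemma smooth_fun_mult: "smooth_fun A a \<Longrightarrow> smooth_fun A b \<Longrightarrow> smooth_fun A (a * b)"
  by (fastforce simp: smooth_fun_def smooth_on_def comp_def
      intro: Ck_on_mult open_chart_image)

lemma smooth_fun_act: "X \<in> V \<Longrightarrow> smooth_fun A a \<Longrightarrow> smooth_fun A (act X a)"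
  by (auto simp: vector_fields_def)

text \<open>
  The three conditions that make \<open>X p\<close> a derivation, its convention on non-smooth functions, and
  smoothness of \<open>X\<close>, unpacked so that the closure properties below are equational.
\<close>

lemma vector_fieldI:
  assumes "\<And>p a b. smooth_fun A a \<Longrightarrow> smooth_fun A b \<Longrightarrow> X p (a + b) = X p a + X p b"
    and "\<And>p c a. smooth_fun A a \<Longrightarrow> X p (\<lambda>q. c * a q) = c * X p a"
    and "\<And>p a b. smooth_fun A a \<Longrightarrow> smooth_fun A b \<Longrightarrow> X p (a * b) = X p a * b p + a p * X p b"
    and "\<And>p a. \<not> smooth_fun A a \<Longrightarrow> X p a = 0"
    and "\<And>a. smooth_fun A a \<Longrightarrow> smooth_fun A (act X a)"
  shows "X \<in> V"
  unfolding vector_fields_def tangent_space_def using assms by blast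

lemma
  assumes "X \<in> V"
  shows vector_field_add: "smooth_fun A a \<Longrightarrow> smooth_fun A b \<Longrightarrow> X p (a + b) = X p a + X p b"
    and vector_field_cmult: "smooth_fun A a \<Longrightarrow> X p (\<lambda>q. c * a q) = c * X p a"
    and vector_field_mult:
      "smooth_fun A a \<Longrightarrow> smooth_fun A b \<Longrightarrow> X p (a * b) = X p a * b p + a p * X p b"
    and vector_field_not_smooth: "\<not> smooth_fun A a \<Longrightarrow> X p a = 0"
  using assms unfolding vector_fields_def tangent_space_def by blast+

lemma add_vector_fields: "X + Y \<in> V" if "X \<in> V" "Y \<in> V"
proof -
  have act: "act (X + Y) a = act X a + act Y a" for a
    by (auto simp: act_def)
  show ?thesis
    by (rule vector_fieldI)
      (simp_all add: that act vector_field_add vector_field_cmult vector_field_mult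
        vector_field_not_smooth smooth_fun_act smooth_fun_add distrib_left distrib_right)
qed

lemma scale_vector_fields: "a \<odot> X \<in> V" if "smooth_fun A a" "X \<in> V"
proof (rule vector_fieldI)
  have "act (a \<odot> X) b = a * act X b" for b
    by (auto simp: act_def scale_def)
  then show "smooth_fun A (act (a \<odot> X) b)" if "smooth_fun A b" for b
    using that \<open>smooth_fun A a\<close> \<open>X \<in> V\<close> by (simp add: smooth_fun_act smooth_fun_mult)
qed (simp_all add: that scale_def vector_field_add vector_field_cmult vector_field_mult
        vector_field_not_smooth distrib_left)

lemma uminus_eq_scale: "- X = (\<lambda>_. - 1) \<odot> X" for X :: "'m vfield"
  by (auto simp: scale_def fun_eq_iff)

lemma uminus_vector_fields: "X \<in> V \<Longrightarrow> - X \<in> V"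
  by (simp add: uminus_eq_scale scale_vector_fields)

lemma diff_vector_fields: "X \<in> V \<Longrightarrow> Y \<in> V \<Longrightarrow> X - Y \<in> V"
  by (metis add_vector_fields uminus_vector_fields diff_conv_add_uminus)

text \<open>The Leibniz rule for \<open>1 * 1 = 1\<close>.\<close>

lemma act_one: "act X 1 = 0" if "X \<in> V"
proof
  fix p
  have "smooth_fun A 1" using smooth_fun_const[of 1] by (simp add: one_fun_def)
  then have "X p (1 * 1) = X p 1 * 1 p + 1 p * X p 1"
    using that unfolding vector_fields_def tangent_space_def by blast
  then show "act X 1 p = 0 p" by (simp add: act_def)
qed

lemma tensor_1_1_in: "tensor_1_1 A T \<Longrightarrow> X \<in> V \<Longrightarrow> T X \<in> V"
  by (auto simp: tensor_1_1_def)

lemma tensor_1_1_add: "tensor_1_1 A T \<Longrightarrow> X \<in> V \<Longrightarrow> Y \<in> V \<Longrightarrow> T (X + Y) = T X + T Y"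
  by (auto simp: tensor_1_1_def)

lemma tensor_1_1_scale:
  "tensor_1_1 A T \<Longrightarrow> smooth_fun A a \<Longrightarrow> X \<in> V \<Longrightarrow> T (a \<odot> X) = a \<odot> T X"
  by (auto simp: tensor_1_1_def)

lemma tensor_1_1_uminus: "tensor_1_1 A T \<Longrightarrow> X \<in> V \<Longrightarrow> T (- X) = - T X"
  by (simp add: uminus_eq_scale tensor_1_1_scale)

lemma tensor_1_1_diff: "tensor_1_1 A T \<Longrightarrow> X \<in> V \<Longrightarrow> Y \<in> V \<Longrightarrow> T (X - Y) = T X - T Y"
  by (metis tensor_1_1_add tensor_1_1_uminus uminus_vector_fields diff_conv_add_uminus)


lemma act_uminus: "act X (- a) = - act X a" if "X \<in> V" "smooth_fun A a"
proof
  fix p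
  show "act X (- a) p = (- act X a) p"
    using vector_field_cmult[OF that, of p "- 1"] by (simp add: act_def fun_Compl_def)
qed

lemma zero_vector_fields: "X \<in> V \<Longrightarrow> 0 \<in> V"
  using diff_vector_fields[of X X] by simp

lemma tensor_1_1_zero: "tensor_1_1 A T \<Longrightarrow> X \<in> V \<Longrightarrow> T 0 = 0"
  using tensor_1_1_diff[of T X X] by simp

lemmas vector_fields_intros =
  add_vector_fields diff_vector_fields uminus_vector_fields scale_vector_fields

end

section \<open>Riemannian manifolds and skew-adjoint operators\<close>

locale riemannian_manifold = smooth_manifold A
  for A :: "('m::{t2_space, second_countable_topology}, 'e::euclidean_space) chart set" +
  fixes g :: "'m vfield \<Rightarrow> 'm vfield \<Rightarrow> 'm \<Rightarrow> real"
    and nabla :: "'m vfield \<Rightarrow> 'm vfield \<Rightarrow> 'm vfield"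
  assumes metric: "riemannian_metric A g"
    and levi_civita: "levi_civita A g nabla"
begin

lemma metric_commute: "X \<in> V \<Longrightarrow> Y \<in> V \<Longrightarrow> g X Y = g Y X"
  using metric by (auto simp: riemannian_metric_def)

lemma one_form_metric: "X \<in> V \<Longrightarrow> one_form A (g X)"
  using metric by (auto simp: riemannian_metric_def)

lemma smooth_fun_metric [simp]: "X \<in> V \<Longrightarrow> Y \<in> V \<Longrightarrow> smooth_fun A (g X Y)"
  using one_form_metric[of X] by (auto simp: one_form_def)

lemma metric_add_right: "X \<in> V \<Longrightarrow> Y \<in> V \<Longrightarrow> Z \<in> V \<Longrightarrow> g X (Y + Z) = g X Y + g X Z"
  using one_form_metric[of X] by (auto simp: one_form_def)

lemma metric_scale_right:
  "X \<in> V \<Longrightarrow> Y \<in> V \<Longrightarrow> smooth_fun A a \<Longrightarrow> g X (a \<odot> Y) = a * g X Y"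
  using one_form_metric[of X] by (auto simp: one_form_def)

lemma metric_uminus_right: "X \<in> V \<Longrightarrow> Y \<in> V \<Longrightarrow> g X (- Y) = - g X Y"
  by (simp add: uminus_eq_scale metric_scale_right fun_eq_iff)

lemma metric_diff_right: "X \<in> V \<Longrightarrow> Y \<in> V \<Longrightarrow> Z \<in> V \<Longrightarrow> g X (Y - Z) = g X Y - g X Z"
  using metric_add_right[of X Y "- Z"] by (simp add: metric_uminus_right uminus_vector_fields)

lemma metric_zero_right: "X \<in> V \<Longrightarrow> g X 0 = 0"
  using metric_diff_right[of X X X] by simp

lemma metric_add_left: "X \<in> V \<Longrightarrow> Y \<in> V \<Longrightarrow> Z \<in> V \<Longrightarrow> g (X + Y) Z = g X Z + g Y Z"
  by (metis metric_add_right metric_commute add_vector_fields)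

lemma metric_scale_left:
  "X \<in> V \<Longrightarrow> Y \<in> V \<Longrightarrow> smooth_fun A a \<Longrightarrow> g (a \<odot> X) Y = a * g X Y"
  by (metis metric_scale_right metric_commute scale_vector_fields)

lemma metric_uminus_left: "X \<in> V \<Longrightarrow> Y \<in> V \<Longrightarrow> g (- X) Y = - g X Y"
  by (metis metric_uminus_right metric_commute uminus_vector_fields)

lemma metric_diff_left: "X \<in> V \<Longrightarrow> Y \<in> V \<Longrightarrow> Z \<in> V \<Longrightarrow> g (X - Y) Z = g X Z - g Y Z"
  by (metis metric_diff_right metric_commute diff_vector_fields)

lemma metric_zero_left: "X \<in> V \<Longrightarrow> g 0 X = 0"
  using metric_diff_left[of X X X] by simp

lemmas metric_linear =
  metric_add_left metric_diff_left metric_uminus_left metric_scale_left metric_zero_left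
  metric_add_right metric_diff_right metric_uminus_right metric_scale_right metric_zero_right

lemma metric_definite: "X = 0" if "X \<in> V" "g X X = 0"
proof (rule ext, rule ccontr)
  fix p assume "X p \<noteq> 0 p"
  then have "g X X p > 0"
    using metric that(1) by (auto simp: riemannian_metric_def)
  with that(2) show False by simp
qed

text \<open>Test the difference against itself; this turns adjoint identities into operator identities.\<close>

lemma metric_eqI: "X = Y" if "X \<in> V" "Y \<in> V" "\<And>Z. Z \<in> V \<Longrightarrow> g X Z = g Y Z"
proof -
  have "X - Y \<in> V" using that by (intro vector_fields_intros)
  then have "g (X - Y) (X - Y) = 0"
    by (simp add: metric_diff_left that)
  with \<open>X - Y \<in> V\<close> show ?thesis using metric_definite[of "X - Y"] by simp
qed

lemma tensor_1_1_nabla: "Y \<in> V \<Longrightarrow> tensor_1_1 A (\<lambda>X. nabla X Y)"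
  using levi_civita by (auto simp: levi_civita_def)

lemma nabla_vector_fields [simp]: "X \<in> V \<Longrightarrow> Y \<in> V \<Longrightarrow> nabla X Y \<in> V"
  using tensor_1_1_nabla tensor_1_1_in by blast

lemma nabla_add_right: "X \<in> V \<Longrightarrow> Y \<in> V \<Longrightarrow> Z \<in> V \<Longrightarrow> nabla X (Y + Z) = nabla X Y + nabla X Z"
  using levi_civita by (auto simp: levi_civita_def)

lemma nabla_zero_right: "nabla X 0 = 0" if "X \<in> V"
  using nabla_add_right[of X 0 0] zero_vector_fields[OF that] that by simp

lemma nabla_zero_left: "X \<in> V \<Longrightarrow> nabla 0 X = 0"
  using tensor_1_1_zero[OF tensor_1_1_nabla] by blast

lemma lie_bracket_eq_nabla:
  "X \<in> V \<Longrightarrow> Y \<in> V \<Longrightarrow> lie_bracket A X Y = nabla X Y - nabla Y X"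
  using levi_civita by (auto simp: levi_civita_def)

lemma act_metric:
  "X \<in> V \<Longrightarrow> Y \<in> V \<Longrightarrow> Z \<in> V \<Longrightarrow> act X (g Y Z) = g (nabla X Y) Z + g Y (nabla X Z)"
  using levi_civita by (auto simp: levi_civita_def)

definition skew_adjoint :: "('m vfield \<Rightarrow> 'm vfield) \<Rightarrow> bool" where
  "skew_adjoint T \<longleftrightarrow>
     (\<forall>X\<in>V. T X \<in> V) \<and> (\<forall>X\<in>V. \<forall>Y\<in>V. g (T X) Y = - g X (T Y))"

lemma skew_adjoint_in: "skew_adjoint T \<Longrightarrow> X \<in> V \<Longrightarrow> T X \<in> V"
  by (simp add: skew_adjoint_def)

lemma skew_adjointD: "skew_adjoint T \<Longrightarrow> X \<in> V \<Longrightarrow> Y \<in> V \<Longrightarrow> g (T X) Y = - g X (T Y)"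
  by (simp add: skew_adjoint_def)

lemma skew_adjoint_diag: "g X (T X) = 0" "g (T X) X = 0" if "skew_adjoint T" "X \<in> V"
proof -
  have "g X (T X) = - g X (T X)"
    using skew_adjointD[OF that(1,2,2)] metric_commute[of X "T X"] that
    by (simp add: skew_adjoint_in)
  then show "g X (T X) = 0" by (simp add: fun_eq_iff)
  then show "g (T X) X = 0" using that by (simp add: skew_adjointD)
qed

lemma cov_deriv_vector_fields:
  "(\<And>Y. Y \<in> V \<Longrightarrow> T Y \<in> V) \<Longrightarrow> X \<in> V \<Longrightarrow> Y \<in> V \<Longrightarrow> cov_deriv nabla X T Y \<in> V"
  by (simp add: cov_deriv_def diff_vector_fields)

text \<open>Differentiate \<open>g(TY, Z) + g(Y, TZ) = 0\<close>; the terms with \<open>\<nabla>\<^sub>XY\<close> or \<open>\<nabla>\<^sub>XZ\<close> regroup into \<open>\<nabla>\<^sub>XT\<close>.\<close>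

lemma skew_adjoint_cov_deriv: "skew_adjoint (cov_deriv nabla X T)"
  if T: "skew_adjoint T" and X: "X \<in> V"
  unfolding skew_adjoint_def
proof (intro conjI ballI)
  note in_V = skew_adjoint_in[OF T]
  show "cov_deriv nabla X T Y \<in> V" if "Y \<in> V" for Y
    using that X in_V by (intro cov_deriv_vector_fields)
  fix Y Z assume YZ: "Y \<in> V" "Z \<in> V"
  have "g (T Y) Z = - g Y (T Z)" using YZ by (rule skew_adjointD[OF T])
  then have "act X (g (T Y) Z) = - act X (g Y (T Z))"
    using YZ X in_V by (simp add: act_uminus)
  then show "g (cov_deriv nabla X T Y) Z = - g Y (cov_deriv nabla X T Z)"
    using YZ X in_V skew_adjointD[OF T, of Y "nabla X Z"] skew_adjointD[OF T, of "nabla X Y" Z]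
    by (simp add: act_metric cov_deriv_def metric_linear algebra_simps)
qed

text \<open>Since \<open>[\<xi>, X] = \<nabla>\<^sub>\<xi>X - \<nabla>\<^sub>X\<xi>\<close>, metric compatibility removes the \<open>\<nabla>\<^sub>\<xi>\<close>-terms from Killing's equation.\<close>

lemma killing_skew_adjoint: "skew_adjoint (\<lambda>X. nabla X \<xi>)" if "killing A g \<xi>"
  unfolding skew_adjoint_def
proof (intro conjI ballI)
  have xi: "\<xi> \<in> V" using that by (simp add: killing_def)
  then show "nabla X \<xi> \<in> V" if "X \<in> V" for X using that by simp
  fix X Y assume XY: "X \<in> V" "Y \<in> V"
  have "act \<xi> (g X Y) - g (lie_bracket A \<xi> X) Y - g X (lie_bracket A \<xi> Y) = 0"
    using that XY by (simp add: killing_def)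
  then show "g (nabla X \<xi>) Y = - g X (nabla Y \<xi>)"
    using XY xi
    by (simp add: act_metric lie_bracket_eq_nabla metric_linear algebra_simps add_eq_0_iff)
qed

text \<open>\<open>g(\<nabla>\<^sub>\<xi>\<xi>, X) = -g(\<xi>, \<nabla>\<^sub>X\<xi>)\<close> is half the derivative of the constant \<open>-g(\<xi>, \<xi>)\<close>; take \<open>X = \<nabla>\<^sub>\<xi>\<xi>\<close>.\<close>

lemma killing_unit_geodesic: "nabla \<xi> \<xi> = 0" if "killing A g \<xi>" "g \<xi> \<xi> = 1"
proof (rule metric_definite)
  have xi: "\<xi> \<in> V" using that by (simp add: killing_def)
  then show "nabla \<xi> \<xi> \<in> V" by simp
  note skew = skew_adjointD[OF killing_skew_adjoint[OF that(1)]]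
  have "act (nabla \<xi> \<xi>) (g \<xi> \<xi>) = 0" using xi that(2) by (simp add: act_one)
  then have "g \<xi> (nabla (nabla \<xi> \<xi>) \<xi>) = 0"
    using xi by (simp add: act_metric metric_commute fun_eq_iff)
  then show "g (nabla \<xi> \<xi>) (nabla \<xi> \<xi>) = 0"
    using xi by (simp add: skew)
qed

text \<open>
  With \<open>\<phi>X = \<nabla>\<^sub>X\<xi>\<close> and \<open>\<nabla>\<^sub>\<xi>\<xi> = 0\<close> one has \<open>R\<^bsub>X,\<xi>\<^esub>\<xi> = -(\<nabla>\<^sub>\<xi>\<phi>)X - \<phi>\<^sup>2X\<close>. In the hypothesis everything except
  the skew operator \<open>N = \<nabla>\<^sub>\<xi>\<phi>\<close> is self-adjoint, so \<open>N\<close> is both skew and self-adjoint, that is \<open>0\<close>.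
\<close>

lemma killing_curvature_imp_square:
  assumes killing: "killing A g \<xi>" and unit: "g \<xi> \<xi> = 1"
    and curv: "\<And>X. X \<in> V \<Longrightarrow> curvature A nabla X \<xi> \<xi> = X - g \<xi> X \<odot> \<xi>"
    and X: "X \<in> V"
  shows "nabla (nabla X \<xi>) \<xi> = g \<xi> X \<odot> \<xi> - X"
proof -
  define \<phi> where "\<phi> = (\<lambda>X. nabla X \<xi>)"
  define N where "N = cov_deriv nabla \<xi> \<phi>"
  have xi: "\<xi> \<in> V" using killing by (simp add: killing_def)
  have skew: "skew_adjoint \<phi>" using killing_skew_adjoint[OF killing] by (simp add: \<phi>_def)
  then have skewN: "skew_adjoint N" unfolding N_def by (rule skew_adjoint_cov_deriv[OF _ xi])
  note in_V = skew_adjoint_in[OF skew] skew_adjoint_in[OF skewN]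
  have N: "N Y = g \<xi> Y \<odot> \<xi> - Y - \<phi> (\<phi> Y)" if Y: "Y \<in> V" for Y
  proof -
    have "curvature A nabla Y \<xi> \<xi> = - N Y - \<phi> (\<phi> Y)"
      using Y xi tensor_1_1_diff[OF tensor_1_1_nabla[OF xi], of "nabla Y \<xi>" "nabla \<xi> Y"]
      by (simp add: curvature_def N_def cov_deriv_def \<phi>_def killing_unit_geodesic[OF killing unit]
          nabla_zero_right lie_bracket_eq_nabla algebra_simps)
    then have "- N Y - \<phi> (\<phi> Y) = Y - g \<xi> Y \<odot> \<xi>" using curv[OF Y] by simp
    then show ?thesis by (simp add: algebra_simps)
  qed
  have "N X = 0"
  proof (rule metric_eqI)
    fix Z assume Z: "Z \<in> V"
    have "g (\<phi> (\<phi> X)) Z = g X (\<phi> (\<phi> Z))"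
      using X Z in_V by (simp add: skew_adjointD[OF skew])
    then have "g (N X) Z = g X (N Z)"
      using X Z xi in_V
      by (simp add: N metric_linear vector_fields_intros metric_commute[of X \<xi>])
    moreover have "g (N X) Z = - g X (N Z)" using X Z by (rule skew_adjointD[OF skewN])
    ultimately show "g (N X) Z = g 0 Z"
      using Z by (simp add: metric_zero_left fun_eq_iff)
  qed (use X in_V zero_vector_fields in auto)
  with N[OF X] show ?thesis by (simp add: \<phi>_def algebra_simps)
qed

end

section \<open>Weak almost-contact metric structures\<close>

locale weak_almost_contact_manifold = riemannian_manifold A g nabla
  for A :: "('m::{t2_space, second_countable_topology}, 'e::euclidean_space) chart set"
    and g :: "'m vfield \<Rightarrow> 'm vfield \<Rightarrow> 'm \<Rightarrow> real"
    and nabla :: "'m vfield \<Rightarrow> 'm vfield \<Rightarrow> 'm vfield" +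
  fixes f Q :: "'m vfield \<Rightarrow> 'm vfield"
    and \<xi> :: "'m vfield"
    and \<eta> :: "'m vfield \<Rightarrow> 'm \<Rightarrow> real"
  assumes wacm: "weak_almost_contact_metric A f Q \<xi> \<eta> g"
begin

lemma xi_in [simp]: "\<xi> \<in> V"
  and tensor_f: "tensor_1_1 A f"
  and tensor_Q: "tensor_1_1 A Q"
  and eta_eq: "X \<in> V \<Longrightarrow> \<eta> X = g \<xi> X"
  using wacm by (auto simp: weak_almost_contact_metric_def)

lemma xi_unit: "g \<xi> \<xi> = 1"
  using wacm by (auto simp: weak_almost_contact_metric_def)

lemma f_square: "X \<in> V \<Longrightarrow> f (f X) = g \<xi> X \<odot> \<xi> - Q X"
  using wacm by (auto simp: weak_almost_contact_metric_def)

lemma metric_f_f: "X \<in> V \<Longrightarrow> Y \<in> V \<Longrightarrow> g (f X) (f Y) = g X (Q Y) - g \<xi> X * g \<xi> Y"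
  using wacm by (auto simp: weak_almost_contact_metric_def)

lemma f_in [simp]: "X \<in> V \<Longrightarrow> f X \<in> V" and Q_in [simp]: "X \<in> V \<Longrightarrow> Q X \<in> V"
  using tensor_f tensor_Q tensor_1_1_in by blast+

lemma Q_surj: "X \<in> V \<Longrightarrow> \<exists>Y\<in>V. Q Y = X"
  using wacm unfolding weak_almost_contact_metric_def nonsingular_def bij_betw_def
  by (metis imageE)

lemma Q_inj: "X \<in> V \<Longrightarrow> Q X = 0 \<Longrightarrow> X = 0"
  using wacm unfolding weak_almost_contact_metric_def nonsingular_def bij_betw_def inj_on_def
  by (metis tensor_Q tensor_1_1_zero zero_vector_fields)

lemma Q_self_adjoint: "g X (Q Y) = g (Q X) Y" if "X \<in> V" "Y \<in> V"
proof -
  have "g (f X) (f Y) = g (f Y) (f X)" using that by (simp add: metric_commute)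
  then show ?thesis using that by (simp add: metric_f_f metric_commute[of "Q X"] algebra_simps)
qed

text \<open>
  The axioms give \<open>g(fX, fY) = -g(X, f\<^sup>2Y)\<close>, so the symmetric form \<open>s(X,Y) = g(fX,Y) + g(X,fY)\<close>
  vanishes when one argument lies in the image of \<open>f\<close>. Every field is \<open>QW = \<eta>(W)\<xi> - f\<^sup>2W\<close> for some
  \<open>W\<close>, so \<open>s(QW,QW') = \<eta>(W)\<eta>(W') t\<close> with \<open>t = s(\<xi>,\<xi>)\<close>, and it remains to prove \<open>t = 0\<close>.

  Let \<open>QZ = \<xi>\<close> and \<open>c = \<eta>(Z)\<close>. From \<open>f\<^sup>2Z = (c - 1)\<xi>\<close> follows \<open>tc = t\<close>: where \<open>t\<close> does not vanish,
  \<open>c = 1\<close>, and then \<open>|fZ|\<^sup>2 = c - c\<^sup>2 = 0\<close>. So \<open>t fZ = 0\<close> and \<open>t s(Z,Z) = 0\<close>. With \<open>QZ' = Z\<close>,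
  \<open>\<eta>(Z') = g(QZ,Z') = g(Z,Z)\<close>, so \<open>s(Z,Z) = |Z|\<^sup>4 t\<close>. Hence \<open>tZ = 0\<close>, so \<open>t = tc = 0\<close>.
\<close>

lemma f_skew_adjoint: "skew_adjoint f"
proof -
  define s where "s X Y = g (f X) Y + g X (f Y)" for X Y
  note f_lin = tensor_1_1_diff[OF tensor_f] tensor_1_1_scale[OF tensor_f]
  have s_commute: "s X Y = s Y X" if "X \<in> V" "Y \<in> V" for X Y
    using that by (simp add: s_def metric_commute)
  have s_f: "s X (f W) = 0" if "X \<in> V" "W \<in> V" for X W
    using that by (simp add: s_def f_square metric_f_f metric_linear vector_fields_intros
        metric_commute[of X \<xi>])
  have decomp: "Q W = g \<xi> W \<odot> \<xi> - f (f W)" if "W \<in> V" for W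
    using that by (simp add: f_square)
  have s_Q: "s (Q W) Y = g \<xi> W * s \<xi> Y" if "W \<in> V" "Y \<in> V" for W Y
  proof -
    have "s (Q W) Y = g \<xi> W * s \<xi> Y - s (f (f W)) Y"
      using that
      by (simp only: decomp s_def f_lin metric_linear vector_fields_intros f_in xi_in smooth_fun_metric)
        (simp add: algebra_simps)
    then show ?thesis using that s_f[of Y "f W"] s_commute[of "f (f W)" Y] by simp
  qed
  define t where "t = s \<xi> \<xi>"
  have s_QQ: "s (Q W) (Q W') = g \<xi> W * g \<xi> W' * t" if "W \<in> V" "W' \<in> V" for W W'
    using that s_Q[of W "Q W'"] s_Q[of W' \<xi>] s_commute[of \<xi> "Q W'"]
    by (simp add: t_def mult.assoc)
  \<comment> \<open>A field killed by \<open>f\<close> is a multiple of \<open>Z = Q\<^sup>-\<^sup>1\<xi>\<close>, as \<open>QX = \<eta>(X)\<xi>\<close> for it; \<open>Z = \<xi>\<close> is not yet known.\<close>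
  obtain Z where Z: "Z \<in> V" "Q Z = \<xi>" using Q_surj[of \<xi>] by auto
  obtain Z' where Z': "Z' \<in> V" "Q Z' = Z" using Q_surj[OF Z(1)] by auto
  define c where "c = g \<xi> Z"
  have smooth [simp]: "smooth_fun A t"
    unfolding t_def s_def using Z by (intro smooth_fun_add) auto
  have ffZ: "f (f Z) = c \<odot> \<xi> - \<xi>" using Z by (simp add: f_square c_def)
  have "s \<xi> (f (f Z)) = c * t - t"
    unfolding ffZ s_def t_def c_def using Z
    by (simp add: f_lin metric_linear vector_fields_intros algebra_simps)
  then have tc: "t * c = t"
    using s_f[of \<xi> "f Z"] Z by (simp add: algebra_simps)
  have "g (t \<odot> f Z) (t \<odot> f Z) = t * (t * (c - c * c))"
    using Z by (simp add: metric_linear vector_fields_intros metric_f_f c_def metric_commute)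
  also have "\<dots> = t * ((t * c) - (t * c) * c)" by (simp add: algebra_simps)
  also have "\<dots> = 0" by (simp add: tc)
  finally have "t \<odot> f Z = 0"
    using Z by (intro metric_definite) (simp_all add: vector_fields_intros)
  then have "t * g (f Z) Z = 0"
    using Z metric_scale_left[of "f Z" Z t] by (simp add: metric_zero_left)
  then have "t * s Z Z = 0"
    using Z by (simp add: s_def metric_commute[of Z "f Z"] fun_eq_iff)
  moreover have "s Z Z = g Z Z * g Z Z * t"
    using s_QQ[OF Z'(1) Z'(1)] Z Z' Q_self_adjoint[of Z Z'] by simp
  ultimately have "t * (g Z Z * g Z Z * t) = 0" by simp
  \<comment> \<open>Pointwise, one of the factors \<open>t\<close> and \<open>g Z Z\<close> vanishes; the exponents do not matter.\<close>
  then have "t * (t * g Z Z) = 0" by (auto simp: fun_eq_iff)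
  then have "t \<odot> Z = 0"
    using Z by (intro metric_definite) (simp_all add: vector_fields_intros metric_linear)
  then have "t * c = 0"
    using Z metric_scale_right[of \<xi> Z t] by (simp add: c_def metric_zero_right)
  with tc have t: "t = 0" by simp
  show ?thesis
    unfolding skew_adjoint_def
  proof (intro conjI ballI)
    fix X Y assume XY: "X \<in> V" "Y \<in> V"
    then obtain W W' where W: "W \<in> V" "W' \<in> V" "X = Q W" "Y = Q W'"
      using Q_surj by metis
    have "s X Y = 0" using s_QQ[OF W(1,2)] t W by simp
    then show "g (f X) Y = - g X (f Y)" by (simp add: s_def eq_neg_iff_add_eq_0)
  qed simp
qed

end

section \<open>Weak quasi-contact metric structures\<close>

locale weak_quasi_contact_manifold = weak_almost_contact_manifold +
  assumes quasi_contact: "weak_quasi_contact_metric A f Q \<xi> \<eta> g nabla"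
begin

abbreviation D where "D X Y \<equiv> cov_deriv nabla X f Y"
abbreviation h where "h \<equiv> h_tensor A f \<xi>"

lemma quasi_contact_eq:
  "X \<in> V \<Longrightarrow> Y \<in> V \<Longrightarrow> D X Y + D (f X) (f Y) =
     (\<lambda>p. 2 * g X Y p) \<odot> \<xi> - g \<xi> Y \<odot> (X + h X + g \<xi> X \<odot> \<xi>)"
  using quasi_contact by (simp add: weak_quasi_contact_metric_def eta_eq)

lemma D_in [simp]: "X \<in> V \<Longrightarrow> Y \<in> V \<Longrightarrow> D X Y \<in> V"
  by (simp add: cov_deriv_vector_fields)

lemma D_skew: "X \<in> V \<Longrightarrow> skew_adjoint (cov_deriv nabla X f)"
  by (rule skew_adjoint_cov_deriv[OF f_skew_adjoint])

lemma h_in [simp]: "X \<in> V \<Longrightarrow> h X \<in> V"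
  by (simp add: h_tensor_def lie_deriv_def lie_bracket_eq_nabla vector_fields_intros)

text \<open>
  Let \<open>u = f\<xi>\<close>, so that \<open>u\<close> is orthogonal to \<open>\<xi>\<close> and \<open>\<eta>(fu) = -g(u,u)\<close>. The quasi-contact equation
  for \<open>(\<xi>, u)\<close>, paired with \<open>u\<close>, gives \<open>g(D\<^sub>u fu, u) = 0\<close> because \<open>D\<^sub>\<xi>\<close> is skew. For \<open>(u, u)\<close>, paired
  with \<open>fu\<close>, the left side is \<open>g(D\<^sub>u u, fu) + g(D\<^bsub>fu\<^esub> fu, fu) = -g(u, D\<^sub>u fu) + 0 = 0\<close>, while the right side is
  \<open>2 g(u,u) \<eta>(fu) = -2 g(u,u)\<^sup>2\<close>.
\<close>

lemma f_xi: "f \<xi> = 0"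
proof -
  define u where "u = f \<xi>"
  have u [simp]: "u \<in> V" by (simp add: u_def)
  have xi_u: "g \<xi> u = 0" unfolding u_def by (simp add: skew_adjoint_diag f_skew_adjoint)
  have xi_fu: "g \<xi> (f u) = - g u u"
    using skew_adjointD[OF f_skew_adjoint, of \<xi> u] by (simp add: u_def)
  have "D \<xi> u + D u (f u) = 0 \<odot> \<xi> - 0 \<odot> (\<xi> + h \<xi> + g \<xi> \<xi> \<odot> \<xi>)"
    using quasi_contact_eq[of \<xi> u] xi_u by (simp add: u_def[symmetric] zero_fun_def)
  then have "D \<xi> u + D u (f u) = 0" by (simp add: scale_def fun_eq_iff)
  then have "g u (D \<xi> u) + g u (D u (f u)) = 0"
    by (metis metric_add_right metric_zero_right D_in u f_in xi_in)
  then have 1: "g u (D u (f u)) = 0" by (simp add: skew_adjoint_diag D_skew)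
  have "D u u + D (f u) (f u) = (\<lambda>p. 2 * g u u p) \<odot> \<xi>"
    using quasi_contact_eq[of u u] xi_u by (simp add: scale_def fun_eq_iff)
  moreover have "smooth_fun A (\<lambda>p. 2 * g u u p)"
    using smooth_fun_add[of "g u u" "g u u"] by (simp add: plus_fun_def)
  ultimately have "g (D u u) (f u) + g (D (f u) (f u)) (f u) = (\<lambda>p. 2 * g u u p) * g \<xi> (f u)"
    by (metis metric_add_left metric_scale_left D_in u f_in xi_in)
  then have "(\<lambda>p. 2 * g u u p) * g u u = 0"
    by (simp add: skew_adjoint_diag D_skew skew_adjointD[OF D_skew] 1 xi_fu)
  then have "g u u = 0" by (auto simp: fun_eq_iff)
  then show ?thesis using metric_definite[of u] by (simp add: u_def)
qed

end

section \<open>The Killing case with the given curvature\<close>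

locale killing_weak_quasi_contact_manifold = weak_quasi_contact_manifold +
  assumes killing_xi: "killing A g \<xi>"
    and curvature_xi: "X \<in> V \<Longrightarrow> curvature A nabla X \<xi> \<xi> = X - g \<xi> X \<odot> \<xi>"
begin

definition \<phi> where "\<phi> X = nabla X \<xi>"

lemma phi_skew: "skew_adjoint \<phi>"
  using killing_skew_adjoint[OF killing_xi] by (simp add: \<phi>_def[abs_def])

lemma phi_in [simp]: "X \<in> V \<Longrightarrow> \<phi> X \<in> V"
  by (simp add: \<phi>_def)

lemma tensor_phi: "tensor_1_1 A \<phi>"
  using tensor_1_1_nabla[OF xi_in] by (simp add: \<phi>_def[abs_def])

lemma phi_xi: "\<phi> \<xi> = 0"
  unfolding \<phi>_def by (rule killing_unit_geodesic[OF killing_xi xi_unit])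

lemma phi_square: "X \<in> V \<Longrightarrow> \<phi> (\<phi> X) = g \<xi> X \<odot> \<xi> - X"
  unfolding \<phi>_def using killing_curvature_imp_square[OF killing_xi xi_unit curvature_xi] .

lemma metric_xi_f: "X \<in> V \<Longrightarrow> g \<xi> (f X) = 0"
  using skew_adjointD[OF f_skew_adjoint, of \<xi> X] by (simp add: f_xi metric_zero_left)

lemma metric_xi_phi: "X \<in> V \<Longrightarrow> g \<xi> (\<phi> X) = 0"
  using skew_adjointD[OF phi_skew, of \<xi> X] by (simp add: phi_xi metric_zero_left)

lemma f_zero: "f 0 = 0" and phi_zero: "\<phi> 0 = 0"
  using tensor_1_1_zero[OF tensor_f xi_in] tensor_1_1_zero[OF tensor_phi xi_in] by auto

lemma two_h_eq: "X \<in> V \<Longrightarrow> h X + h X = D \<xi> X - \<phi> (f X) + f (\<phi> X)"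
  by (simp add: h_tensor_def lie_deriv_def lie_bracket_eq_nabla cov_deriv_def \<phi>_def
      tensor_1_1_diff[OF tensor_f] scale_def fun_eq_iff)

text \<open>The quasi-contact equation for \<open>X = \<xi>\<close>: since \<open>f\<xi> = 0\<close> and \<open>h\<xi> = 0\<close>, its right side cancels.\<close>

lemma D_xi: "D \<xi> Y = 0" if "Y \<in> V"
proof -
  have "D \<xi> \<xi> = 0"
    using phi_xi by (simp add: cov_deriv_def f_xi \<phi>_def f_zero nabla_zero_right)
  then have "h \<xi> + h \<xi> = 0"
    using two_h_eq[of \<xi>] by (simp add: f_xi phi_xi f_zero phi_zero)
  then have h: "h \<xi> = 0" by (simp add: fun_eq_iff)
  have "D (f \<xi>) (f Y) = 0"
    using that by (simp add: cov_deriv_def f_xi f_zero nabla_zero_left)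
  then have "D \<xi> Y = (\<lambda>p. 2 * g \<xi> Y p) \<odot> \<xi> - g \<xi> Y \<odot> (\<xi> + 0 + 1 \<odot> \<xi>)"
    using quasi_contact_eq[of \<xi> Y] that by (simp add: h xi_unit)
  also have "\<dots> = 0" by (simp add: scale_def fun_eq_iff algebra_simps)
  finally show ?thesis .
qed

lemma D_right_xi: "D X \<xi> = - f (\<phi> X)" if "X \<in> V"
  using that by (simp add: cov_deriv_def f_xi nabla_zero_right \<phi>_def)

text \<open>The quasi-contact equation for \<open>Y = \<xi>\<close>, solved for \<open>h\<close>.\<close>

lemma h_eq: "h X = f (\<phi> X) + \<phi> (\<phi> X)" if "X \<in> V"
proof -
  have "D (f X) (f \<xi>) = 0"
    using that by (simp add: cov_deriv_def f_xi f_zero nabla_zero_right)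
  then have "- f (\<phi> X) = (\<lambda>p. 2 * g X \<xi> p) \<odot> \<xi> - 1 \<odot> (X + h X + g \<xi> X \<odot> \<xi>)"
    using quasi_contact_eq[of X \<xi>] that by (simp add: D_right_xi xi_unit)
  then show ?thesis
    using that metric_commute[of X \<xi>]
    by (simp add: phi_square scale_def fun_eq_iff algebra_simps)
qed

text \<open>Eliminate \<open>h\<close> between \<open>2h = f\<phi> - \<phi>f\<close> and \<open>h = f\<phi> + \<phi>\<^sup>2\<close>.\<close>

lemma f_phi_anticommutator: "f (\<phi> X) + \<phi> (f X) = - (\<phi> (\<phi> X) + \<phi> (\<phi> X))" if "X \<in> V"
  using two_h_eq[OF that] h_eq[OF that] D_xi[OF that]
  by (simp add: eq_neg_iff_add_eq_0 fun_eq_iff algebra_simps)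

text \<open>
  The \<open>\<xi>\<close>-component of the quasi-contact equation. By skewness of \<open>D\<close> and \<open>D\<^sub>X\<xi> = -f\<phi>X\<close>, the left
  side is \<open>g(f\<phi>X, Y) + g(f\<phi>fX, fY) = g(f\<phi>X + Q\<phi>fX, Y)\<close>; the right side is \<open>-2g(\<phi>\<^sup>2X, Y)\<close>, because
  \<open>h\<close> takes values orthogonal to \<open>\<xi>\<close>. Comparison with the anticommutator of \<open>f\<close> and \<open>\<phi>\<close> gives the claim.
\<close>

lemma Q_phi_f: "Q (\<phi> (f X)) = \<phi> (f X)" if X: "X \<in> V"
proof -
  have "f (\<phi> X) + Q (\<phi> (f X)) = f (\<phi> X) + \<phi> (f X)"
  proof (rule metric_eqI)
    fix Y assume Y: "Y \<in> V"
    have two: "smooth_fun A (\<lambda>p. 2 * g X Y p)"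
      using smooth_fun_add[of "g X Y" "g X Y"] X Y by (simp add: plus_fun_def)
    have 1: "g \<xi> (D Z W) = g (f (\<phi> Z)) W" if "Z \<in> V" "W \<in> V" for Z W
      using that skew_adjointD[OF D_skew, of Z \<xi> W]
      by (simp add: D_right_xi metric_linear)
    have 2: "g (f (\<phi> (f X))) (f Y) = g (Q (\<phi> (f X))) Y"
      using X Y by (simp add: metric_f_f metric_xi_phi Q_self_adjoint)
    have hX: "g \<xi> (h X) = 0"
      using X by (simp add: h_eq metric_linear metric_xi_f metric_xi_phi)
    have "g \<xi> (D X Y + D (f X) (f Y)) =
        g \<xi> ((\<lambda>p. 2 * g X Y p) \<odot> \<xi> - g \<xi> Y \<odot> (X + h X + g \<xi> X \<odot> \<xi>))"
      using X Y by (simp add: quasi_contact_eq)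
    then have "g (f (\<phi> X) + Q (\<phi> (f X))) Y =
        (\<lambda>p. 2 * g X Y p) - g \<xi> Y * (g \<xi> X + g \<xi> X)"
      using X Y two by (simp add: metric_linear vector_fields_intros 1 2 hX xi_unit)
    also have "\<dots> = g (- (\<phi> (\<phi> X) + \<phi> (\<phi> X))) Y"
    proof -
      have "g (\<phi> (\<phi> X)) Y = g \<xi> X * g \<xi> Y - g X Y"
        using X Y by (simp add: phi_square metric_linear vector_fields_intros)
      then show ?thesis
        using X Y by (simp only: metric_linear vector_fields_intros phi_in)
          (simp add: fun_eq_iff algebra_simps)
    qed
    also have "\<dots> = g (f (\<phi> X) + \<phi> (f X)) Y"
      using X by (simp add: f_phi_anticommutator)
    finally show "g (f (\<phi> X) + Q (\<phi> (f X))) Y = g (f (\<phi> X) + \<phi> (f X)) Y" .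
  qed (use X in \<open>auto intro: vector_fields_intros\<close>)
  then show ?thesis by simp
qed

text \<open>
  Taking adjoints in \<open>Q\<phi>f = \<phi>f\<close> gives \<open>f\<phi>Q = f\<phi>\<close>, so \<open>f\<phi>\<close> annihilates \<open>W = QX - X\<close>. Since
  \<open>f\<^sup>2 = -Q\<close> and \<open>\<phi>\<^sup>2 = -id\<close> on fields orthogonal to \<open>\<xi>\<close>, and \<open>Q\<close> is injective, \<open>W\<close> is a multiple of
  \<open>\<xi>\<close>; that multiple is \<open>\<eta>(QX) - \<eta>(X) = 0\<close> because \<open>Q\<xi> = \<xi>\<close>.
\<close>

lemma Q_eq_id: "Q X = X" if X: "X \<in> V"
proof -
  define W where "W = Q X - X"
  have W [simp]: "W \<in> V" using X by (simp add: W_def diff_vector_fields)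
  have "f (\<phi> (Q X)) = f (\<phi> X)"
  proof (rule metric_eqI)
    fix Z assume Z: "Z \<in> V"
    have 1: "g (f (\<phi> Y)) Z = g Y (\<phi> (f Z))" if "Y \<in> V" for Y
      using that Z by (simp add: skew_adjointD[OF f_skew_adjoint] skew_adjointD[OF phi_skew])
    show "g (f (\<phi> (Q X))) Z = g (f (\<phi> X)) Z"
      using X Z Q_self_adjoint[of X "\<phi> (f Z)"] by (simp add: 1 Q_phi_f)
  qed (use X in auto)
  then have "f (\<phi> W) = 0"
    using X by (simp add: W_def tensor_1_1_diff[OF tensor_f] tensor_1_1_diff[OF tensor_phi])
  then have "f (f (\<phi> W)) = 0" by (simp add: f_zero)
  then have "Q (\<phi> W) = 0"
    using f_square[of "\<phi> W"] by (simp add: metric_xi_phi scale_def fun_eq_iff)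
  then have "\<phi> W = 0" by (simp add: Q_inj)
  then have W_eq: "W = g \<xi> W \<odot> \<xi>"
    using phi_square[of W] by (simp add: phi_zero)
  have "Q \<xi> = \<xi>"
    using f_square[of \<xi>] by (simp add: f_xi f_zero xi_unit scale_def fun_eq_iff)
  then have "g \<xi> W = 0"
    using X Q_self_adjoint[of \<xi> X] by (simp add: W_def metric_linear)
  with W_eq have "W = 0" by (simp add: scale_def fun_eq_iff)
  then show ?thesis by (simp add: W_def)
qed

text \<open>
  Now \<open>f\<^sup>2 = \<phi>\<^sup>2\<close>, so \<open>k = f + \<phi>\<close> satisfies \<open>k\<^sup>2 = 2\<phi>\<^sup>2 + (f\<phi> + \<phi>f) = 0\<close>, and \<open>|kX|\<^sup>2 = -g(X, k\<^sup>2X) = 0\<close>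
  as \<open>k\<close> is skew.
\<close>

lemma f_eq_uminus_phi: "f X = - \<phi> X" if X: "X \<in> V"
proof -
  define k where "k Y = f Y + \<phi> Y" for Y
  have k_skew: "skew_adjoint k"
    by (simp add: skew_adjoint_def k_def add_vector_fields metric_add_left metric_add_right
        skew_adjointD[OF f_skew_adjoint] skew_adjointD[OF phi_skew])
  have "k (k X) = f (f X) + (f (\<phi> X) + \<phi> (f X)) + \<phi> (\<phi> X)"
    using X by (simp add: k_def tensor_1_1_add[OF tensor_f] tensor_1_1_add[OF tensor_phi]
        add_vector_fields algebra_simps)
  also have "\<dots> = 0"
    using X by (simp add: f_phi_anticommutator f_square phi_square Q_eq_id)
  finally have "k (k X) = 0" .
  then have "g (k X) (k X) = 0"
    using X by (simp add: skew_adjointD[OF k_skew] skew_adjoint_in[OF k_skew] metric_zero_right)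
  then have "k X = 0" using X skew_adjoint_in[OF k_skew] metric_definite by blast
  then show ?thesis by (simp add: k_def add_eq_0_iff2)
qed

text \<open>\<open>2d\<eta>(X,Y) = g(\<phi>X,Y) - g(\<phi>Y,X) = 2g(\<phi>X,Y)\<close>, and \<open>g(\<phi>X,Y) = -g(X,\<phi>Y) = g(X,fY)\<close>.\<close>

lemma K_contact: "K_contact A f \<xi> \<eta> g"
proof -
  have "almost_contact_metric A f \<xi> \<eta> g"
    using wacm Q_eq_id
    by (simp add: almost_contact_metric_def weak_almost_contact_metric_def nonsingular_def
        tensor_1_1_def)
  moreover have "ext_deriv A \<eta> X Y = g X (f Y)" if X: "X \<in> V" and Y: "Y \<in> V" for X Y
  proof -
    have "g (\<phi> X) Y - g (\<phi> Y) X = g X (f Y) + g X (f Y)"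
      using X Y by (simp add: f_eq_uminus_phi skew_adjointD[OF phi_skew, of X Y] metric_linear
          metric_commute[of "\<phi> Y"])
    then show ?thesis
      using X Y
      by (simp add: ext_deriv_def eta_eq lie_bracket_eq_nabla diff_vector_fields act_metric
          metric_linear \<phi>_def fun_eq_iff)
  qed
  ultimately show ?thesis
    using killing_xi by (simp add: K_contact_def contact_metric_def)
qed

end

theorem theorem4:
  fixes n :: nat
    and A :: "('m::{t2_space, second_countable_topology}, 'e::euclidean_space) chart set"
    and f Q :: "'m vfield \<Rightarrow> 'm vfield"
    and \<xi> :: "'m vfield"
    and \<eta> :: "'m vfield \<Rightarrow> 'm \<Rightarrow> real"
    and g :: "'m vfield \<Rightarrow> 'm vfield \<Rightarrow> 'm \<Rightarrow> real"
    and nabla :: "'m vfield \<Rightarrow> 'm vfield \<Rightarrow> 'm vfield"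
  assumes "smooth_atlas A"
    and "DIM('e) = 2 * n + 1"
    and "weak_quasi_contact_metric A f Q \<xi> \<eta> g nabla"
    and "\<forall>X\<in>vector_fields A. curvature A nabla X \<xi> \<xi> = X - \<eta> X \<odot> \<xi>"
    and "killing A g \<xi>"
  shows "(\<forall>X\<in>vector_fields A. Q X = X) \<and> K_contact A f \<xi> \<eta> g"
proof -
  have wacm: "weak_almost_contact_metric A f Q \<xi> \<eta> g"
    using assms(3) by (simp add: weak_quasi_contact_metric_def)
  interpret killing_weak_quasi_contact_manifold A g nabla f Q \<xi> \<eta>
    using assms wacm
    by unfold_locales (simp_all add: weak_quasi_contact_metric_def weak_almost_contact_metric_def)
  show ?thesis using Q_eq_id K_contact by blast
qed

end
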